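(* Let $N\ge2$, $\phi\in[-\pi,\pi)$ and $\theta\in[0,\frac{\pi}{2}]$, and let $|\Psi_\phi^\theta\rangle=\cos\theta\,|0\rangle^{\otimes N}+e^{i\phi}\sin\theta\,|1\rangle^{\otimes N}\in(\mathbb{C}^2)^{\otimes N}$. Define $$\mathcal{W}^2_{\Psi_\phi^\theta}=\frac{2\max\{\cos^2\theta,\sin^2\theta\}+1}{4}\,\mathbb{I}-\mathcal{Z}-\tfrac14\cos(2\theta)\,\mathcal{M}_z-\tfrac14\sin(2\theta)\left(\cos\phi\,\mathcal{M}_x+\sin\phi\,\mathcal{M}_x'\right),$$ where $\mathcal{Z}=\frac12\left((|0\rangle\langle0|)^{\otimes N}+(|1\rangle\langle1|)^{\otimes N}\right)$, $\mathcal{M}_z=\sigma_z\otimes\mathbb{I}^{\otimes(N-1)}$, $\mathcal{M}_x=\sigma_x^{\otimes N}$ and $\mathcal{M}_x'=\sigma_y\otimes\sigma_x^{\otimes (N-1)}$. Then $\mathcal{W}^2_{\Psi_\phi^\theta}$ is an entanglement witness that detects entanglement near $|\Psi_\phi^\theta\rangle$, that is, $\mathrm{Tr}(\mathcal{W}^2_{\Psi_\phi^\theta}\sigma_s)\ge0$ for every $\sigma_s\in\mathcal{S}_{sep}$, and $\langle\Psi_\phi^\theta|\mathcal{W}^2_{\Psi_\phi^\theta}|\Psi_\phi^\theta\rangle<0$ whenever $|\Psi_\phi^\theta\rangle$ is entangled, i.e. whenever $\theta\in(0,\frac{\pi}{2})$.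
   Context: The Hilbert space is that of $N$ qubits, $(\mathbb{C}^2)^{\otimes N}$; $\sigma_x,\sigma_y,\sigma_z$ are the Pauli matrices and $\mathbb{I}$ is the identity. The superscript $2$ in $\mathcal{W}^2_{\Psi_\phi^\theta}$ is a label, not a power. $\mathcal{S}_{sep}$ denotes the convex set of separable $N$-qubit states relevant to genuine multipartite entanglement: the convex hull of all pure states $|\chi\rangle\langle\chi|$ such that $|\chi\rangle=|\alpha\rangle_A\otimes|\beta\rangle_{\bar A}$ for some bipartition $A\sqcup\bar A$ of the $N$ qubits into two nonempty sets (the bipartition may differ from one term of the mixture to another). An entanglement witness detecting a state $\rho$ is a Hermitian operator $\mathcal{W}$ with $\mathrm{Tr}(\mathcal{W}\sigma_s)\ge0$ for all $\sigma_s\in\mathcal{S}_{sep}$ and $\mathrm{Tr}(\mathcal{W}\rho)<0$. *)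

theory Defs
  imports "HOL-Analysis.Analysis" "HOL-Library.Complex_Order"
begin

text \<open>
  The qubits are labelled by the elements of a finite type \<^typ>\<open>'n\<close>, so that \<open>N = CARD('n)\<close>, and
  \<open>(\<complex>\<^sup>2)\<^sup>\<otimes>\<^sup>N\<close> has the computational basis indexed by the configurations \<^typ>\<open>'n \<Rightarrow> 2\<close>. The entries
  of \<^typ>\<open>complex ^ 2\<close> are listed by \<^const>\<open>vector\<close>: the first one has index \<open>1\<close>, the second
  one index \<open>2\<close> (which equals \<open>0\<close> in the type \<^typ>\<open>2\<close>). All single-qubit objects are given this way,
  so \<open>|0\<rangle>\<close> is the vector whose first entry is \<open>1\<close>.
\<close>

type_synonym 'n qstate = "complex ^ ('n \<Rightarrow> 2)"
type_synonym 'n qop = "complex ^ ('n \<Rightarrow> 2) ^ ('n \<Rightarrow> 2)"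

definition ket0 :: "complex ^ 2" where
  "ket0 = vector [1, 0]"

definition ket1 :: "complex ^ 2" where
  "ket1 = vector [0, 1]"

definition sigma_x :: "complex ^ 2 ^ 2" where
  "sigma_x = vector [vector [0, 1], vector [1, 0]]"

definition sigma_y :: "complex ^ 2 ^ 2" where
  "sigma_y = vector [vector [0, - \<i>], vector [\<i>, 0]]"

definition sigma_z :: "complex ^ 2 ^ 2" where
  "sigma_z = vector [vector [1, 0], vector [0, - 1]]"

definition tensor_vec :: "('n::finite \<Rightarrow> complex ^ 2) \<Rightarrow> 'n qstate" where
  "tensor_vec v = (\<chi> x. \<Prod>i\<in>UNIV. v i $ x i)"

definition tensor_op :: "('n::finite \<Rightarrow> complex ^ 2 ^ 2) \<Rightarrow> 'n qop" where
  "tensor_op A = (\<chi> x y. \<Prod>i\<in>UNIV. A i $ x i $ y i)"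

definition ketbra :: "complex ^ 'm \<Rightarrow> complex ^ 'm ^ 'm" where
  "ketbra \<psi> = (\<chi> x y. \<psi> $ x * cnj (\<psi> $ y))"

definition hermitian :: "complex ^ 'm ^ 'm \<Rightarrow> bool" where
  "hermitian A \<longleftrightarrow> (\<forall>x y. A $ x $ y = cnj (A $ y $ x))"

definition expectation :: "complex ^ 'm ^ 'm \<Rightarrow> complex ^ 'm \<Rightarrow> complex" where
  "expectation A \<psi> = (\<Sum>x\<in>UNIV. cnj (\<psi> $ x) * (A *v \<psi>) $ x)"

text \<open>
  An element of \<open>(\<complex>\<^sup>2)\<^sup>\<otimes>\<^sup>A\<close> is a function on the configurations of the qubits in \<open>A\<close>, represented by
  the functions \<^term>\<open>restrict x A\<close>. The factors \<open>\<alpha>\<close> and \<open>\<beta>\<close> are not normalised separately, since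
  only unit vectors \<open>\<chi>\<close> enter the set of separable states.
\<close>

definition product_across :: "'n set \<Rightarrow> 'n::finite qstate \<Rightarrow> bool" where
  "product_across A \<psi> \<longleftrightarrow>
     (\<exists>\<alpha> \<beta> :: ('n \<Rightarrow> 2) \<Rightarrow> complex. \<forall>x. \<psi> $ x = \<alpha> (restrict x A) * \<beta> (restrict x (- A)))"

definition separable_states :: "'n::finite qop set" where
  "separable_states =
     convex hull {ketbra \<psi> |\<psi>. norm \<psi> = 1 \<and> (\<exists>A. A \<noteq> {} \<and> - A \<noteq> {} \<and> product_across A \<psi>)}"

text \<open>
  The order on \<^typ>\<open>complex\<close> is the one in which \<open>a \<le> b\<close> means \<open>Re a \<le> Re b\<close> and \<open>Im a = Im b\<close>;
  an inequality with \<open>0\<close> thus includes that the quantity is real.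
\<close>

definition entanglement_witness :: "'n::finite qop \<Rightarrow> 'n qop \<Rightarrow> bool" where
  "entanglement_witness W \<rho> \<longleftrightarrow>
     hermitian W \<and> (\<forall>\<sigma>\<in>separable_states. 0 \<le> trace (W ** \<sigma>)) \<and> trace (W ** \<rho>) < 0"

definition Psi :: "real \<Rightarrow> real \<Rightarrow> 'n::finite qstate" where
  "Psi \<phi> \<theta> = complex_of_real (cos \<theta>) *s tensor_vec (\<lambda>_. ket0)
     + (exp (\<i> * complex_of_real \<phi>) * complex_of_real (sin \<theta>)) *s tensor_vec (\<lambda>_. ket1)"

definition Z_op :: "'n::finite qop" where
  "Z_op = (1 / 2) *\<^sub>R (tensor_op (\<lambda>_. ketbra ket0) + tensor_op (\<lambda>_. ketbra ket1))"

text \<open>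
  The argument \<open>q\<close> below is the label of the first tensor factor.
\<close>

definition Mz :: "'n \<Rightarrow> 'n::finite qop" where
  "Mz q = tensor_op (\<lambda>i. if i = q then sigma_z else mat 1)"

definition Mx :: "'n::finite qop" where
  "Mx = tensor_op (\<lambda>_. sigma_x)"

definition Mx' :: "'n \<Rightarrow> 'n::finite qop" where
  "Mx' q = tensor_op (\<lambda>i. if i = q then sigma_y else sigma_x)"

definition W2 :: "'n \<Rightarrow> real \<Rightarrow> real \<Rightarrow> 'n::finite qop" where
  "W2 q \<phi> \<theta> =
     ((2 * max ((cos \<theta>)\<^sup>2) ((sin \<theta>)\<^sup>2) + 1) / 4) *\<^sub>R mat 1
     - Z_op
     - (1 / 4 * cos (2 * \<theta>)) *\<^sub>R Mz q
     - (1 / 4 * sin (2 * \<theta>)) *\<^sub>R (cos \<phi> *\<^sub>R Mx + sin \<phi> *\<^sub>R Mx' q)"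

end

theory Submission
  imports Defs
begin

text \<open>
  With \<open>m = max (cos\<^sup>2 \<theta>) (sin\<^sup>2 \<theta>)\<close>, the operator \<open>W2\<close> dominates the projector witness
  \<open>(m I - |\<Psi>\<rangle>\<langle>\<Psi>|) / 2\<close> and has the same expectation \<open>(m - 1) / 2\<close> at \<open>\<Psi>\<close>. Both facts are seen on
  the two-dimensional spaces spanned by a basis vector and the one with all qubits flipped, which
  are invariant under \<open>W2\<close>. It then remains to bound \<open>|\<langle>\<Psi>|\<psi>\<rangle>|\<^sup>2\<close> by \<open>m\<close> for product vectors \<open>\<psi>\<close>,
  which follows from \<open>\<psi>\<^sub>0\<^sub>0 \<psi>\<^sub>1\<^sub>1 = \<psi>\<^sub>0\<^sub>1 \<psi>\<^sub>1\<^sub>0\<close>, where the two indices are the common values of the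
  qubits on the two sides of the bipartition.
\<close>

section \<open>Flipping all qubits of a configuration\<close>

text \<open>
  The label \<open>0\<close> of the paper is the index \<open>1\<close>, so \<^term>\<open>\<lambda>_. 1\<close> and \<^term>\<open>\<lambda>_. 2\<close> are the configurations
  of \<open>|0\<rangle>\<^sup>\<otimes>\<^sup>N\<close> and \<open>|1\<rangle>\<^sup>\<otimes>\<^sup>N\<close>.
\<close>

definition flip :: "('n \<Rightarrow> 2) \<Rightarrow> 'n \<Rightarrow> 2" where
  "flip x = (\<lambda>i. if x i = 1 then 2 else 1)"

lemma flip_flip [simp]: "flip (flip x) = x"
proof
  show "flip (flip x) i = x i" for i
    using exhaust_2[of "x i"] by (auto simp: flip_def)
qed

lemma flip_neq [simp]: "flip x \<noteq> x" "x \<noteq> flip x"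
  by (auto simp: flip_def fun_eq_iff)

lemma flip_eq_one_iff [simp]: "flip x i = 1 \<longleftrightarrow> x i \<noteq> 1"
  by (auto simp: flip_def)

lemma flip_eq_const_two_iff [simp]: "flip x = (\<lambda>_. 2) \<longleftrightarrow> x = (\<lambda>_. 1)"
  by (metis (no_types, lifting) ext flip_def flip_flip)

section \<open>Matrix entries in the computational basis\<close>

lemma prod_if_zero:
  fixes f :: "'n::finite \<Rightarrow> 'a::comm_semiring_1"
  shows "(\<Prod>i\<in>UNIV. if P i then f i else 0) = (if \<forall>i. P i then \<Prod>i\<in>UNIV. f i else 0)"
proof (cases "\<forall>i. P i")
  case False
  then obtain i where "\<not> P i" by blast
  then have "\<exists>i\<in>UNIV. (if P i then f i else 0) = 0"
    by (intro bexI[of _ i]) simp_all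
  then have "(\<Prod>i\<in>UNIV. if P i then f i else 0) = 0"
    by (rule prod_zero[OF finite])
  with False show ?thesis
    by (simp only: if_False)
qed simp

text \<open>A local factor with at most one nonzero entry per row gives a tensor product with the
  same property. For fixed \<open>x\<close>, the column \<open>z\<close> is \<open>x\<close> itself
  for diagonal factors and \<open>flip x\<close> for \<open>sigma_x\<close> and
  \<open>sigma_y\<close>.\<close>

lemma tensor_op_nth:
  fixes x y :: "'n::finite \<Rightarrow> 2"
  assumes "\<And>i. A i $ x i $ y i = (if y i = z i then f i else 0)"
  shows "tensor_op A $ x $ y = (if y = z then \<Prod>i\<in>UNIV. f i else 0)"
  by (simp add: tensor_op_def assms prod_if_zero fun_eq_iff)

lemma tensor_vec_ket0_nth: "tensor_vec (\<lambda>_. ket0) $ x = (if x = (\<lambda>_. 1) then 1 else 0)"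
proof -
  have "ket0 $ k = (if k = 1 then 1 else 0)" for k
    using exhaust_2[of k] by (auto simp: ket0_def)
  then show ?thesis by (simp add: tensor_vec_def prod_if_zero fun_eq_iff)
qed

lemma tensor_vec_ket1_nth: "tensor_vec (\<lambda>_. ket1) $ x = (if x = (\<lambda>_. 2) then 1 else 0)"
proof -
  have "ket1 $ k = (if k = 2 then 1 else 0)" for k
    using exhaust_2[of k] by (auto simp: ket1_def)
  then show ?thesis by (simp add: tensor_vec_def prod_if_zero fun_eq_iff)
qed

lemma Psi_nth:
  "Psi \<phi> \<theta> $ x = (if x = (\<lambda>_. 1) then complex_of_real (cos \<theta>)
     else if x = (\<lambda>_. 2) then cis \<phi> * complex_of_real (sin \<theta>) else 0)"
  by (auto simp: Psi_def tensor_vec_ket0_nth tensor_vec_ket1_nth cis_conv_exp fun_eq_iff)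

lemma Z_op_nth:
  "Z_op $ x $ y = (if y = x \<and> (x = (\<lambda>_. 1) \<or> x = (\<lambda>_. 2)) then 1 / 2 else 0)"
proof -
  have "ketbra ket0 $ k $ l = (if l = k then (if k = 1 then 1 else 0) else 0)" for k l
    using exhaust_2[of k] exhaust_2[of l] by (auto simp: ketbra_def ket0_def)
  then have 0: "tensor_op (\<lambda>_. ketbra ket0) $ x $ y = (if y = x then if x = (\<lambda>_. 1) then 1 else 0 else 0)"
    by (subst tensor_op_nth[where z = x]) (auto simp: prod_if_zero fun_eq_iff)
  have "ketbra ket1 $ k $ l = (if l = k then (if k = 2 then 1 else 0) else 0)" for k l
    using exhaust_2[of k] exhaust_2[of l] by (auto simp: ketbra_def ket1_def)
  then have 1: "tensor_op (\<lambda>_. ketbra ket1) $ x $ y = (if y = x then if x = (\<lambda>_. 2) then 1 else 0 else 0)"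
    by (subst tensor_op_nth[where z = x]) (auto simp: prod_if_zero fun_eq_iff)
  show ?thesis
    by (auto simp: Z_op_def 0 1 fun_eq_iff scaleR_conv_of_real[where 'a = complex])
qed

lemma Mz_nth: "Mz q $ x $ y = (if y = x then if x q = 1 then 1 else - 1 else 0)"
  unfolding Mz_def
proof (subst tensor_op_nth[where z = x])
  fix i
  show "(if i = q then sigma_z else mat 1) $ x i $ y i
      = (if y i = x i then if i = q then if x q = 1 then 1 else - 1 else 1 else 0)"
    using exhaust_2[of "x i"] exhaust_2[of "y i"] by (auto simp: sigma_z_def mat_def)
qed simp

lemma Mx_nth: "Mx $ x $ y = (if y = flip x then 1 else 0)"
  unfolding Mx_def
proof (subst tensor_op_nth[where z = "flip x"])
  fix i
  show "sigma_x $ x i $ y i = (if y i = flip x i then 1 else 0)"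
    using exhaust_2[of "x i"] exhaust_2[of "y i"] by (auto simp: sigma_x_def flip_def)
qed simp

lemma Mx'_nth: "Mx' q $ x $ y = (if y = flip x then if x q = 1 then - \<i> else \<i> else 0)"
  unfolding Mx'_def
proof (subst tensor_op_nth[where z = "flip x"])
  fix i
  show "(if i = q then sigma_y else sigma_x) $ x i $ y i
      = (if y i = flip x i then if i = q then if x q = 1 then - \<i> else \<i> else 1 else 0)"
    using exhaust_2[of "x i"] exhaust_2[of "y i"] by (auto simp: sigma_x_def sigma_y_def flip_def)
qed simp

definition W2_diag :: "'n \<Rightarrow> real \<Rightarrow> ('n \<Rightarrow> 2) \<Rightarrow> real" where
  "W2_diag q \<theta> x = (2 * max ((cos \<theta>)\<^sup>2) ((sin \<theta>)\<^sup>2) + 1) / 4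
     - (if x = (\<lambda>_. 1) \<or> x = (\<lambda>_. 2) then 1 / 2 else 0)
     - cos (2 * \<theta>) / 4 * (if x q = 1 then 1 else - 1)"

text \<open>The combination of \<open>Mx\<close> and \<open>Mx'\<close> has the entries cos \<phi>
  -+ i sin \<phi> at \<open>flip x\<close>, hence a pure phase whose sign is set by qubit
  \<open>q\<close>.\<close>

lemma W2_nth:
  "W2 q \<phi> \<theta> $ x $ y = (if y = x then complex_of_real (W2_diag q \<theta> x)
     else if y = flip x then - complex_of_real (sin (2 * \<theta>) / 4) * cis (if x q = 1 then - \<phi> else \<phi>)
     else 0)"
  by (simp add: W2_def W2_diag_def Z_op_nth Mz_nth Mx_nth Mx'_nth mat_def complex_eq_iff)

lemma W2_mult_nth:
  "(W2 q \<phi> \<theta> *v \<psi>) $ x = complex_of_real (W2_diag q \<theta> x) * \<psi> $ x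
     - complex_of_real (sin (2 * \<theta>) / 4) * cis (if x q = 1 then - \<phi> else \<phi>) * \<psi> $ flip x"
proof -
  have "(W2 q \<phi> \<theta> *v \<psi>) $ x = (\<Sum>y\<in>UNIV. (if y = x then complex_of_real (W2_diag q \<theta> x) * \<psi> $ x else 0)
     + (if y = flip x then - complex_of_real (sin (2 * \<theta>) / 4) * cis (if x q = 1 then - \<phi> else \<phi>) * \<psi> $ flip x else 0))"
    unfolding matrix_vector_mult_def vec_lambda_beta
    by (rule sum.cong) (auto simp: W2_nth)
  then show ?thesis
    by (simp add: sum.distrib)
qed

text \<open>Transposing exchanges \<open>x\<close> and \<open>flip x\<close>, which differ at
  \<open>q\<close>, so the phase is conjugated.\<close>

lemma hermitian_W2: "hermitian (W2 q \<phi> \<theta>)"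
  unfolding hermitian_def
proof (intro allI)
  fix x y
  show "W2 q \<phi> \<theta> $ x $ y = cnj (W2 q \<phi> \<theta> $ y $ x)"
  proof (cases "y = flip x")
    case True
    then show ?thesis by (auto simp: W2_nth cis_cnj)
  next
    case False
    then have "x \<noteq> flip y" by auto
    with False show ?thesis by (simp add: W2_nth)
  qed
qed

section \<open>Expectation values as sums over flip orbits\<close>

lemma trace_mult_ketbra: "trace (A ** ketbra \<psi>) = expectation A \<psi>"
  by (simp add: trace_def expectation_def matrix_matrix_mult_def matrix_vector_mult_def
      ketbra_def sum_distrib_left mult_ac)

lemma hermitian_expectation_real:
  assumes "hermitian A"
  shows "Im (expectation A \<psi>) = 0"
proof -
  have swap: "cnj (A $ x $ y) = A $ y $ x" for x y
    using assms unfolding hermitian_def by (metis complex_cnj_cnj)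
  have "cnj (expectation A \<psi>) = (\<Sum>x\<in>UNIV. \<Sum>y\<in>UNIV. cnj (A $ x $ y) * \<psi> $ x * cnj (\<psi> $ y))"
    by (simp add: expectation_def matrix_vector_mult_def sum_distrib_left mult_ac)
  also have "\<dots> = (\<Sum>x\<in>UNIV. \<Sum>y\<in>UNIV. A $ y $ x * \<psi> $ x * cnj (\<psi> $ y))"
    by (simp only: swap)
  also have "\<dots> = expectation A \<psi>"
    by (subst sum.swap) (simp add: expectation_def matrix_vector_mult_def sum_distrib_left mult_ac)
  finally show ?thesis
    by (simp add: complex_eq_iff)
qed

text \<open>Exactly one of \<open>x\<close> and \<open>flip x\<close> has the value 1 at
  \<open>q\<close>, so these \<open>x\<close> represent the orbits of \<open>flip\<close>.\<close>

lemma sum_flip_pairs: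
  fixes f :: "('n::finite \<Rightarrow> 2) \<Rightarrow> 'a::comm_monoid_add"
  shows "(\<Sum>x\<in>UNIV. f x) = (\<Sum>x | x q = 1. f x + f (flip x))"
proof -
  have "(\<Sum>x\<in>UNIV. f x) = (\<Sum>x | x q = 1. f x) + (\<Sum>x | x q \<noteq> 1. f x)"
    by (subst sum.union_disjoint[symmetric]) (auto intro!: sum.cong)
  also have "(\<Sum>x | x q \<noteq> 1. f x) = (\<Sum>x | x q = 1. f (flip x))"
    by (rule sum.reindex_bij_witness[of _ flip flip]) auto
  finally show ?thesis
    by (simp add: sum.distrib)
qed

lemma norm_Psi: "norm (Psi \<phi> \<theta> :: 'n::finite qstate) = 1"
proof -
  have "(\<Sum>x\<in>UNIV. (cmod ((Psi \<phi> \<theta> :: 'n qstate) $ x))\<^sup>2)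
     = (\<Sum>x::'n \<Rightarrow> 2\<in>UNIV. (if x = (\<lambda>_. 1) then (cos \<theta>)\<^sup>2 else 0) + (if x = (\<lambda>_. 2) then (sin \<theta>)\<^sup>2 else 0))"
    by (rule sum.cong) (auto simp: Psi_nth norm_mult fun_eq_iff)
  also have "\<dots> = 1"
    by (simp add: sum.distrib)
  finally show ?thesis
    by (simp add: norm_vec_def L2_set_def)
qed

lemma norm_sq_flip_pairs:
  fixes \<psi> :: "'n::finite qstate"
  shows "(norm \<psi>)\<^sup>2 = (\<Sum>x | x q = 1. (cmod (\<psi> $ x))\<^sup>2 + (cmod (\<psi> $ flip x))\<^sup>2)"
  by (simp add: norm_vec_def L2_set_def sum_nonneg sum_flip_pairs[of _ q])

text \<open>
  On the span of \<open>|x\<rangle>\<close> and \<open>|flip x\<rangle>\<close> the operator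
  \<open>cos (2\<theta>) M\<^sub>z + sin (2\<theta>) (cos \<phi> M\<^sub>x + sin \<phi> M\<^sub>x')\<close> is the reflection \<open>2|v\<rangle>\<langle>v| - I\<close>
  with \<open>v = cos \<theta> |x\<rangle> + exp (i\<phi>) sin \<theta> |flip x\<rangle>\<close>.
\<close>

lemma Re_expectation_W2:
  fixes \<psi> :: "'n::finite qstate"
  shows "Re (expectation (W2 q \<phi> \<theta>) \<psi>) = (\<Sum>x | x q = 1.
     ((max ((cos \<theta>)\<^sup>2) ((sin \<theta>)\<^sup>2) + (if x = (\<lambda>_. 1) then 0 else 1)) / 2)
       * ((cmod (\<psi> $ x))\<^sup>2 + (cmod (\<psi> $ flip x))\<^sup>2)
     - (cmod (complex_of_real (cos \<theta>) * \<psi> $ x + complex_of_real (sin \<theta>) * cis (- \<phi>) * \<psi> $ flip x))\<^sup>2 / 2)"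
proof -
  \<comment> \<open>One orbit: \<open>a\<close> and \<open>b\<close> are the components at
    \<open>x\<close> and \<open>flip x\<close>, \<open>k\<close> is the coefficient of the identity
    and \<open>r\<close> the contribution of \<open>Z_op\<close>. The extra 1/4 comes from the
    identity part of the reflection.\<close>
  have pair: "Re (cnj a * (complex_of_real (k + r - cos (2 * \<theta>) / 4) * a
           - complex_of_real (sin (2 * \<theta>) / 4) * cis (- \<phi>) * b))
       + Re (cnj b * (complex_of_real (k + r + cos (2 * \<theta>) / 4) * b
           - complex_of_real (sin (2 * \<theta>) / 4) * cis \<phi> * a))
     = (k + r + 1 / 4) * ((cmod a)\<^sup>2 + (cmod b)\<^sup>2)
       - (cmod (complex_of_real (cos \<theta>) * a + complex_of_real (sin \<theta>) * cis (- \<phi>) * b))\<^sup>2 / 2"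
    for a b k r
  proof -
    \<comment> \<open>The two interference terms are conjugate to each other, so both have real part
      \<open>R\<close>.\<close>
    define R where "R = Re (cnj a * (cis (- \<phi>) * b))"
    have sq: "(cmod (x + y))\<^sup>2 = (cmod x)\<^sup>2 + (cmod y)\<^sup>2 + 2 * Re (cnj x * y)" for x y
      unfolding cmod_power2 by (simp add: power2_eq_square algebra_simps)
    have scale: "Re (cnj z * (complex_of_real c * z - complex_of_real d * u * w))
        = c * (cmod z)\<^sup>2 - d * Re (cnj z * (u * w))" for c d z u w
      unfolding cmod_power2 by (simp add: power2_eq_square algebra_simps)
    have R: "Re (cnj b * (cis \<phi> * a)) = R"
      by (simp add: R_def algebra_simps)
    have "Re (cnj (complex_of_real (cos \<theta>) * a) * (complex_of_real (sin \<theta>) * cis (- \<phi>) * b))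
        = cos \<theta> * sin \<theta> * R"
      by (simp add: R_def algebra_simps)
    then have v: "(cmod (complex_of_real (cos \<theta>) * a + complex_of_real (sin \<theta>) * cis (- \<phi>) * b))\<^sup>2
        = (cos \<theta>)\<^sup>2 * (cmod a)\<^sup>2 + (1 - (cos \<theta>)\<^sup>2) * (cmod b)\<^sup>2 + 2 * (cos \<theta> * sin \<theta> * R)"
      unfolding sq by (simp add: norm_mult power_mult_distrib sin_squared_eq)
    show ?thesis
      unfolding scale R R_def[symmetric] v cos_double_cos sin_double
      by (simp add: field_simps)
  qed
  have "Re (expectation (W2 q \<phi> \<theta>) \<psi>) = (\<Sum>x | x q = 1.
      Re (cnj (\<psi> $ x) * (W2 q \<phi> \<theta> *v \<psi>) $ x)
      + Re (cnj (\<psi> $ flip x) * (W2 q \<phi> \<theta> *v \<psi>) $ flip x))"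
    unfolding expectation_def by (subst sum_flip_pairs[of _ q]) simp
  also have "\<dots> = (\<Sum>x | x q = 1.
     ((max ((cos \<theta>)\<^sup>2) ((sin \<theta>)\<^sup>2) + (if x = (\<lambda>_. 1) then 0 else 1)) / 2)
       * ((cmod (\<psi> $ x))\<^sup>2 + (cmod (\<psi> $ flip x))\<^sup>2)
     - (cmod (complex_of_real (cos \<theta>) * \<psi> $ x + complex_of_real (sin \<theta>) * cis (- \<phi>) * \<psi> $ flip x))\<^sup>2 / 2)"
  proof (rule sum.cong)
    fix x :: "'n \<Rightarrow> 2"
    assume "x \<in> {x. x q = 1}"
    then have x: "x q = 1" by simp
    define k where "k = (2 * max ((cos \<theta>)\<^sup>2) ((sin \<theta>)\<^sup>2) + 1) / 4"
    \<comment> \<open>The same \<open>r\<close> serves both diagonal entries: when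
      \<open>x q = 1\<close>, the configuration of all 2 can occur only as \<open>flip x\<close>,
      and then \<open>x\<close> is constantly 1.\<close>
    define r :: real where "r = - (if x = (\<lambda>_. 1) then 1 / 2 else 0)"
    have ne: "x \<noteq> (\<lambda>_. 2)" "flip x \<noteq> (\<lambda>_. 1)" "flip x q \<noteq> 1"
      using x flip_eq_one_iff[of x q] by force+
    with ne x have "W2_diag q \<theta> x = k + r - cos (2 * \<theta>) / 4"
      "W2_diag q \<theta> (flip x) = k + r + cos (2 * \<theta>) / 4"
      by (auto simp: W2_diag_def k_def r_def)
    moreover have "k + r + 1 / 4 = (max ((cos \<theta>)\<^sup>2) ((sin \<theta>)\<^sup>2) + (if x = (\<lambda>_. 1) then 0 else 1)) / 2"
      by (simp add: k_def r_def field_simps)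
    ultimately show "Re (cnj (\<psi> $ x) * (W2 q \<phi> \<theta> *v \<psi>) $ x)
      + Re (cnj (\<psi> $ flip x) * (W2 q \<phi> \<theta> *v \<psi>) $ flip x)
      = ((max ((cos \<theta>)\<^sup>2) ((sin \<theta>)\<^sup>2) + (if x = (\<lambda>_. 1) then 0 else 1)) / 2)
       * ((cmod (\<psi> $ x))\<^sup>2 + (cmod (\<psi> $ flip x))\<^sup>2)
     - (cmod (complex_of_real (cos \<theta>) * \<psi> $ x + complex_of_real (sin \<theta>) * cis (- \<phi>) * \<psi> $ flip x))\<^sup>2 / 2"
      using pair[of "\<psi> $ x" k r "\<psi> $ flip x"] x ne by (simp add: W2_mult_nth)
  qed simp
  finally show ?thesis .
qed

section \<open>Comparison with the projector witness\<close>

lemma cmod_Psi_component_le: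
  "(cmod (complex_of_real (cos \<theta>) * a + complex_of_real (sin \<theta>) * cis \<phi> * b))\<^sup>2 \<le> (cmod a)\<^sup>2 + (cmod b)\<^sup>2"
proof -
  have "cmod (complex_of_real (cos \<theta>) * a + complex_of_real (sin \<theta>) * cis \<phi> * b)
      \<le> \<bar>cos \<theta>\<bar> * cmod a + \<bar>sin \<theta>\<bar> * cmod b"
    by (rule norm_triangle_le) (simp add: norm_mult)
  then have "(cmod (complex_of_real (cos \<theta>) * a + complex_of_real (sin \<theta>) * cis \<phi> * b))\<^sup>2
      \<le> (\<bar>cos \<theta>\<bar> * cmod a + \<bar>sin \<theta>\<bar> * cmod b)\<^sup>2"
    by (rule power_mono) simp
  \<comment> \<open>Adding this square completes Lagrange's identity, which gives Cauchy-Schwarz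
    against a unit vector.\<close>
  also have "\<dots> \<le> (\<bar>cos \<theta>\<bar> * cmod a + \<bar>sin \<theta>\<bar> * cmod b)\<^sup>2 + (\<bar>sin \<theta>\<bar> * cmod a - \<bar>cos \<theta>\<bar> * cmod b)\<^sup>2"
    by simp
  also have "\<dots> = (\<bar>cos \<theta>\<bar>\<^sup>2 + \<bar>sin \<theta>\<bar>\<^sup>2) * ((cmod a)\<^sup>2 + (cmod b)\<^sup>2)"
    by algebra
  finally show ?thesis
    by simp
qed

text \<open>The two sides agree on the orbit of the constant configurations. On every other orbit
  \<open>W2\<close> has an additional half of the squared norm, which pays for the subtracted half
  of a squared overlap.\<close>

lemma Re_expectation_W2_ge:
  fixes \<psi> :: "'n::finite qstate"
  shows "(max ((cos \<theta>)\<^sup>2) ((sin \<theta>)\<^sup>2) * (norm \<psi>)\<^sup>2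
     - (cmod (complex_of_real (cos \<theta>) * \<psi> $ (\<lambda>_. 1)
         + complex_of_real (sin \<theta>) * cis (- \<phi>) * \<psi> $ (\<lambda>_. 2)))\<^sup>2) / 2
     \<le> Re (expectation (W2 q \<phi> \<theta>) \<psi>)"
proof -
  let ?m = "max ((cos \<theta>)\<^sup>2) ((sin \<theta>)\<^sup>2)"
  let ?p = "\<lambda>x. (cmod (\<psi> $ x))\<^sup>2 + (cmod (\<psi> $ flip x))\<^sup>2"
  let ?v = "\<lambda>x. (cmod (complex_of_real (cos \<theta>) * \<psi> $ x + complex_of_real (sin \<theta>) * cis (- \<phi>) * \<psi> $ flip x))\<^sup>2"
  have "(?m * (norm \<psi>)\<^sup>2 - ?v (\<lambda>_. 1)) / 2
      = (\<Sum>x | x q = 1. ?m / 2 * ?p x - (if x = (\<lambda>_. 1) then ?v (\<lambda>_. 1) / 2 else 0))"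
    by (simp add: norm_sq_flip_pairs[of \<psi> q] sum_subtractf diff_divide_distrib
        flip: sum_distrib_left sum_divide_distrib)
  also have "\<dots> \<le> Re (expectation (W2 q \<phi> \<theta>) \<psi>)"
    unfolding Re_expectation_W2
  proof (rule sum_mono)
    fix x :: "'n \<Rightarrow> 2"
    show "?m / 2 * ?p x - (if x = (\<lambda>_. 1) then ?v (\<lambda>_. 1) / 2 else 0)
      \<le> (?m + (if x = (\<lambda>_. 1) then 0 else 1)) / 2 * ?p x - ?v x / 2"
      using cmod_Psi_component_le[of \<theta> "\<psi> $ x" "- \<phi>" "\<psi> $ flip x"]
      by (simp add: distrib_right add_divide_distrib)
  qed
  finally show ?thesis
    by (simp add: flip_def)
qed

text \<open>\<open>Psi\<close> lives on the orbit of the constant configurations and coincides there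
  with the vector \<open>v\<close> of the reflection, so both its squared norm and its squared
  overlap with \<open>v\<close> are 1.\<close>

lemma Re_expectation_W2_Psi:
  fixes q :: "'n::finite"
  shows "Re (expectation (W2 q \<phi> \<theta>) (Psi \<phi> \<theta>)) = (max ((cos \<theta>)\<^sup>2) ((sin \<theta>)\<^sup>2) - 1) / 2"
proof -
  have "Re (expectation (W2 q \<phi> \<theta>) (Psi \<phi> \<theta>))
      = (\<Sum>x::'n \<Rightarrow> 2 | x q = 1. if x = (\<lambda>_. 1) then (max ((cos \<theta>)\<^sup>2) ((sin \<theta>)\<^sup>2) - 1) / 2 else 0)"
    unfolding Re_expectation_W2
  proof (rule sum.cong)
    fix x :: "'n \<Rightarrow> 2"
    assume "x \<in> {x. x q = 1}"
    then have ne: "x \<noteq> (\<lambda>_. 2)" "flip x \<noteq> (\<lambda>_. 1)"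
      using flip_eq_one_iff[of x q] by force+
    have "complex_of_real (sin \<theta>) * cis (- \<phi>) * (cis \<phi> * complex_of_real (sin \<theta>))
        = complex_of_real ((sin \<theta>)\<^sup>2)"
      using cis_mult[of "- \<phi>" \<phi>] by (simp add: power2_eq_square mult_ac)
    then have "complex_of_real (cos \<theta>) * complex_of_real (cos \<theta>)
        + complex_of_real (sin \<theta>) * cis (- \<phi>) * (cis \<phi> * complex_of_real (sin \<theta>)) = 1"
      by (metis of_real_1 of_real_add of_real_mult power2_eq_square sin_cos_squared_add2)
    then show "(max ((cos \<theta>)\<^sup>2) ((sin \<theta>)\<^sup>2) + (if x = (\<lambda>_. 1) then 0 else 1)) / 2 *
         ((cmod (Psi \<phi> \<theta> $ x))\<^sup>2 + (cmod (Psi \<phi> \<theta> $ flip x))\<^sup>2) -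
         (cmod (complex_of_real (cos \<theta>) * Psi \<phi> \<theta> $ x +
           complex_of_real (sin \<theta>) * cis (- \<phi>) * Psi \<phi> \<theta> $ flip x))\<^sup>2 / 2
       = (if x = (\<lambda>_. 1) then (max ((cos \<theta>)\<^sup>2) ((sin \<theta>)\<^sup>2) - 1) / 2 else 0)"
      using ne by (simp add: Psi_nth norm_mult diff_divide_distrib)
  qed simp
  then show ?thesis
    by simp
qed

section \<open>Overlap of \<open>Psi\<close> with product vectors\<close>

text \<open>The maximum is the larger squared Schmidt coefficient of \<open>Psi\<close> across the
  bipartition. The left side is a squared overlap with \<open>Psi\<close> once \<phi> is replaced by
  its negative.\<close>

lemma product_across_overlap_le:
  fixes \<psi> :: "'n::finite qstate"
  assumes "product_across A \<psi>" "A \<noteq> {}" "- A \<noteq> {}"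
  shows "(cmod (complex_of_real (cos \<theta>) * \<psi> $ (\<lambda>_. 1)
      + complex_of_real (sin \<theta>) * cis \<phi> * \<psi> $ (\<lambda>_. 2)))\<^sup>2
    \<le> max ((cos \<theta>)\<^sup>2) ((sin \<theta>)\<^sup>2) * (norm \<psi>)\<^sup>2"
proof -
  let ?m = "max ((cos \<theta>)\<^sup>2) ((sin \<theta>)\<^sup>2)"
  define M where "M = max \<bar>cos \<theta>\<bar> \<bar>sin \<theta>\<bar>"
  \<comment> \<open>The digits are the ket labels on \<open>A\<close> and on its complement; digit 0
    is index 1 and digit 1 is index 2.\<close>
  define x00 x11 x01 x10 :: "'n \<Rightarrow> 2" where
    "x00 = (\<lambda>_. 1)" and "x11 = (\<lambda>_. 2)"
    and "x01 = (\<lambda>i. if i \<in> A then 1 else 2)" and "x10 = (\<lambda>i. if i \<in> A then 2 else 1)"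
  obtain \<alpha> \<beta> where \<psi>: "\<And>x. \<psi> $ x = \<alpha> (restrict x A) * \<beta> (restrict x (- A))"
    using assms(1) unfolding product_across_def by blast
  have restr: "restrict x01 A = restrict x00 A" "restrict x01 (- A) = restrict x11 (- A)"
    "restrict x10 A = restrict x11 A" "restrict x10 (- A) = restrict x00 (- A)"
    by (auto simp: x00_def x11_def x01_def x10_def restrict_def)
  obtain i j where ij: "i \<in> A" "j \<notin> A"
    using assms(2,3) by blast
  \<comment> \<open>Both sides of the bipartition are nonempty, so the four squared moduli are
    different terms of the squared norm.\<close>
  have distinct: "distinct [x00, x11, x01, x10]"
    using ij by (auto simp: x00_def x11_def x01_def x10_def fun_eq_iff)
  have M2: "M\<^sup>2 = ?m"
    unfolding M_def by (simp add: max_def abs_le_square_iff)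
  have cross: "cmod (\<psi> $ x00) * cmod (\<psi> $ x11) = cmod (\<psi> $ x01) * cmod (\<psi> $ x10)"
    by (simp add: \<psi> restr norm_mult)
  have "cmod (complex_of_real (cos \<theta>) * \<psi> $ x00 + complex_of_real (sin \<theta>) * cis \<phi> * \<psi> $ x11)
      \<le> \<bar>cos \<theta>\<bar> * cmod (\<psi> $ x00) + \<bar>sin \<theta>\<bar> * cmod (\<psi> $ x11)"
    by (rule norm_triangle_le) (simp add: norm_mult)
  also have "\<dots> \<le> M * (cmod (\<psi> $ x00) + cmod (\<psi> $ x11))"
    unfolding distrib_left by (intro add_mono mult_right_mono) (auto simp: M_def)
  finally have "(cmod (complex_of_real (cos \<theta>) * \<psi> $ x00 + complex_of_real (sin \<theta>) * cis \<phi> * \<psi> $ x11))\<^sup>2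
      \<le> (M * (cmod (\<psi> $ x00) + cmod (\<psi> $ x11)))\<^sup>2"
    by (rule power_mono) simp
  also have "\<dots> = ?m * (cmod (\<psi> $ x00) + cmod (\<psi> $ x11))\<^sup>2"
    by (simp add: power_mult_distrib M2)
  also have "\<dots> \<le> ?m * (norm \<psi>)\<^sup>2"
  proof (rule mult_left_mono)
    have "(cmod (\<psi> $ x00) + cmod (\<psi> $ x11))\<^sup>2
       = (cmod (\<psi> $ x00))\<^sup>2 + (cmod (\<psi> $ x11))\<^sup>2 + 2 * (cmod (\<psi> $ x01) * cmod (\<psi> $ x10))"
      unfolding cross[symmetric] by (simp add: power2_sum)
    also have "\<dots> \<le> (cmod (\<psi> $ x00))\<^sup>2 + (cmod (\<psi> $ x11))\<^sup>2 + ((cmod (\<psi> $ x01))\<^sup>2 + (cmod (\<psi> $ x10))\<^sup>2)"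
      using sum_squares_bound[of "cmod (\<psi> $ x01)" "cmod (\<psi> $ x10)"] by simp
    also have "\<dots> = (\<Sum>x\<in>{x00, x11, x01, x10}. (cmod (\<psi> $ x))\<^sup>2)"
      using distinct by simp
    also have "\<dots> \<le> (\<Sum>x\<in>UNIV. (cmod (\<psi> $ x))\<^sup>2)"
      by (rule sum_mono2) auto
    also have "\<dots> = (norm \<psi>)\<^sup>2"
      by (simp add: norm_vec_def L2_set_def sum_nonneg)
    finally show "(cmod (\<psi> $ x00) + cmod (\<psi> $ x11))\<^sup>2 \<le> (norm \<psi>)\<^sup>2" .
  qed (simp add: le_max_iff_disj)
  finally show ?thesis
    by (simp add: x00_def x11_def)
qed

section \<open>Separable states\<close>

text \<open>The trace against \<open>W\<close> is linear, so nonnegativity defines a convex set and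
  passes from the pure generators to their hull.\<close>

lemma trace_nonneg_separable:
  fixes W :: "'n::finite qop"
  assumes "\<And>\<psi> A. norm \<psi> = 1 \<Longrightarrow> A \<noteq> {} \<Longrightarrow> - A \<noteq> {} \<Longrightarrow> product_across A \<psi>
      \<Longrightarrow> 0 \<le> expectation W \<psi>"
    and "\<sigma> \<in> separable_states"
  shows "0 \<le> trace (W ** \<sigma>)"
proof -
  have "convex {\<sigma>. 0 \<le> trace (W ** \<sigma>)}"
  proof (rule convexI)
    fix \<sigma> \<tau> and u v :: real
    assume *: "\<sigma> \<in> {\<sigma>. 0 \<le> trace (W ** \<sigma>)}" "\<tau> \<in> {\<sigma>. 0 \<le> trace (W ** \<sigma>)}" "0 \<le> u" "0 \<le> v"
    have "trace (W ** (u *\<^sub>R \<sigma> + v *\<^sub>R \<tau>)) = u *\<^sub>R trace (W ** \<sigma>) + v *\<^sub>R trace (W ** \<tau>)"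
      by (simp add: trace_def matrix_matrix_mult_def scaleR_sum_right sum.distrib distrib_left)
    with * show "u *\<^sub>R \<sigma> + v *\<^sub>R \<tau> \<in> {\<sigma>. 0 \<le> trace (W ** \<sigma>)}"
      by (simp add: less_eq_complex_def)
  qed
  then have "separable_states \<subseteq> {\<sigma>. 0 \<le> trace (W ** \<sigma>)}"
    unfolding separable_states_def
  proof (rule hull_minimal[rotated], intro subsetI)
    fix \<sigma> :: "'n qop"
    assume "\<sigma> \<in> {ketbra \<psi> |\<psi>. norm \<psi> = 1 \<and> (\<exists>A. A \<noteq> {} \<and> - A \<noteq> {} \<and> product_across A \<psi>)}"
    then obtain \<psi> A where "\<sigma> = ketbra \<psi>" "norm \<psi> = 1" "A \<noteq> {}" "- A \<noteq> {}" "product_across A \<psi>"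
      by blast
    then show "\<sigma> \<in> {\<sigma>. 0 \<le> trace (W ** \<sigma>)}"
      using assms(1) by (simp add: trace_mult_ketbra)
  qed
  with assms(2) show ?thesis by blast
qed

lemma trace_W2_separable_nonneg:
  assumes "\<sigma> \<in> separable_states"
  shows "0 \<le> trace (W2 q \<phi> \<theta> ** \<sigma>)"
proof (rule trace_nonneg_separable[OF _ assms])
  fix \<psi> :: "'a qstate" and A
  assume "norm \<psi> = 1" "A \<noteq> {}" "- A \<noteq> {}" "product_across A \<psi>"
  then have "0 \<le> Re (expectation (W2 q \<phi> \<theta>) \<psi>)"
    using Re_expectation_W2_ge[of \<theta> \<psi> \<phi> q] product_across_overlap_le[of A \<psi> \<theta> "- \<phi>"] by simp
  then show "0 \<le> expectation (W2 q \<phi> \<theta>) \<psi>"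
    by (simp add: less_eq_complex_def hermitian_expectation_real hermitian_W2)
qed

text \<open>This makes \<open>Psi\<close> separable at the two ends of the range of \<theta>, where
  only one basis vector survives.\<close>

lemma product_across_tensor_vec: "product_across A (c *s tensor_vec v)"
proof -
  have "(\<Prod>i\<in>UNIV. v i $ x i) = (\<Prod>i\<in>A. v i $ restrict x A i) * (\<Prod>i\<in>- A. v i $ restrict x (- A) i)" for x
    using prod.union_disjoint[of A "- A" "\<lambda>i. v i $ x i"] by (simp add: Compl_partition)
  then show ?thesis
    unfolding product_across_def
    by (intro exI[of _ "\<lambda>y. c * (\<Prod>i\<in>A. v i $ y i)"] exI[of _ "\<lambda>y. \<Prod>i\<in>- A. v i $ y i"])
      (simp add: tensor_vec_def mult.assoc)
qed

theorem theorem4: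
  fixes \<phi> \<theta> :: real and q :: "'n::finite"
  assumes "CARD('n) \<ge> 2"
    and "\<phi> \<in> {- pi..<pi}"
    and "\<theta> \<in> {0..pi / 2}"
  shows "hermitian (W2 q \<phi> \<theta>)
    \<and> (\<forall>\<sigma>\<in>separable_states. 0 \<le> trace (W2 q \<phi> \<theta> ** \<sigma>))
    \<and> (ketbra (Psi \<phi> \<theta> :: 'n qstate) \<notin> separable_states \<longleftrightarrow> \<theta> \<in> {0<..<pi / 2})
    \<and> (\<theta> \<in> {0<..<pi / 2} \<longrightarrow>
         expectation (W2 q \<phi> \<theta>) (Psi \<phi> \<theta>) < 0
         \<and> entanglement_witness (W2 q \<phi> \<theta>) (ketbra (Psi \<phi> \<theta>)))"
proof -
  have neg: "expectation (W2 q \<phi> \<theta>) (Psi \<phi> \<theta>) < 0" if "\<theta> \<in> {0<..<pi / 2}"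
  proof -
    have "0 < sin \<theta>" "0 < cos \<theta>"
      using that by (auto intro: sin_gt_zero2 cos_gt_zero)
    then have "0 < (sin \<theta>)\<^sup>2" "0 < (cos \<theta>)\<^sup>2"
      by simp_all
    then have "max ((cos \<theta>)\<^sup>2) ((sin \<theta>)\<^sup>2) < 1"
      using sin_cos_squared_add[of \<theta>] by linarith
    then show ?thesis
      by (simp add: less_complex_def Re_expectation_W2_Psi hermitian_expectation_real hermitian_W2)
  qed
  have sep: "ketbra (Psi \<phi> \<theta> :: 'n qstate) \<in> separable_states" if \<theta>: "\<theta> \<notin> {0<..<pi / 2}"
  proof -
    consider "\<theta> = 0" | "\<theta> = pi / 2"
      using \<theta> assms(3) by force
    then have "(Psi \<phi> \<theta> :: 'n qstate) = 1 *s tensor_vec (\<lambda>_. ket0)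
        \<or> (Psi \<phi> \<theta> :: 'n qstate) = exp (\<i> * complex_of_real \<phi>) *s tensor_vec (\<lambda>_. ket1)"
      by cases (simp_all only: Psi_def, simp_all)
    then have "product_across {q} (Psi \<phi> \<theta> :: 'n qstate)"
      using product_across_tensor_vec by metis
    \<comment> \<open>With at least two qubits, splitting off \<open>q\<close> is a genuine
      bipartition.\<close>
    moreover have "- {q} \<noteq> {}"
    proof
      assume "- {q} = {}"
      then have "(UNIV :: 'n set) = {q}" by blast
      then have "CARD('n) = 1" by (metis card.empty card.insert empty_iff finite.emptyI One_nat_def)
      with assms(1) show False by simp
    qed
    ultimately show ?thesis
      unfolding separable_states_def
      by (intro hull_inc) (use norm_Psi in blast)
  qed
  have pos: "0 \<le> trace (W2 q \<phi> \<theta> ** \<sigma>)" if "\<sigma> \<in> separable_states" for \<sigma>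
    by (rule trace_W2_separable_nonneg[OF that])
  have wit: "entanglement_witness (W2 q \<phi> \<theta>) (ketbra (Psi \<phi> \<theta>))" if "\<theta> \<in> {0<..<pi / 2}"
    unfolding entanglement_witness_def
  proof (intro conjI ballI)
    show "trace (W2 q \<phi> \<theta> ** ketbra (Psi \<phi> \<theta>)) < 0"
      unfolding trace_mult_ketbra by (rule neg[OF that])
  qed (simp_all only: pos hermitian_W2)
  \<comment> \<open>The witness itself certifies entanglement: its trace would be both nonnegative
    and negative.\<close>
  have "ketbra (Psi \<phi> \<theta> :: 'n qstate) \<notin> separable_states" if "\<theta> \<in> {0<..<pi / 2}"
  proof
    assume "ketbra (Psi \<phi> \<theta> :: 'n qstate) \<in> separable_states"
    from pos[OF this] neg[OF that] show False
      by (simp add: trace_mult_ketbra less_eq_complex_def less_complex_def)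
  qed
  with sep have "ketbra (Psi \<phi> \<theta> :: 'n qstate) \<notin> separable_states \<longleftrightarrow> \<theta> \<in> {0<..<pi / 2}"
    by metis
  with neg pos wit hermitian_W2 show ?thesis
    by (intro conjI ballI impI)
qed

end
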